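(* Let $G$ be a connected graph on $n$ vertices which has a bipartite $2$-connected block not isomorphic to $C_4$, or has at least two blocks isomorphic to $C_4$. Then $\eta(G)\ge 4n$.
   Context: All graphs are finite and simple. $C_k$ is the cycle of length $k$. A block of a graph is a maximal connected subgraph without a cut-vertex of its own; a block is either a $2$-connected subgraph (on at least $3$ vertices), a single edge, or an isolated vertex; single edges and isolated vertices are not $2$-connected. For a connected graph $G=(V,E)$, $d(a,b)$ is the length of a shortest path between $a$ and $b$. The Wiener index is $W(G)=\sum_{\{a,b\}\subseteq V} d(a,b)$ (sum over unordered pairs of vertices). The Szeged index is $\mathrm{Sz}(G)=\sum_{ab\in E} n_{ab}(a)\cdot n_{ab}(b)$, where $n_{ab}(a)$ is the number of vertices strictly closer to $a$ than to $b$, and $n_{ab}(b)$ is the number of vertices strictly closer to $b$ than to $a$. Define $\eta(G)=\mathrm{Sz}(G)-W(G)$. *)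

theory Defs
  imports Main
begin

section \<open>Finite simple graphs\<close>

datatype 'a ugraph = UGraph (verts: "'a set") (edges: "'a set set")

definition simple_graph :: "'a ugraph \<Rightarrow> bool" where
  "simple_graph G \<longleftrightarrow> finite (verts G) \<and> (\<forall>e\<in>edges G. e \<subseteq> verts G \<and> card e = 2)"

definition subgraph :: "'a ugraph \<Rightarrow> 'a ugraph \<Rightarrow> bool" where
  "subgraph H G \<longleftrightarrow> simple_graph H \<and> verts H \<subseteq> verts G \<and> edges H \<subseteq> edges G"

definition remove_vertex :: "'a ugraph \<Rightarrow> 'a \<Rightarrow> 'a ugraph" where
  "remove_vertex G v = UGraph (verts G - {v}) {e \<in> edges G. v \<notin> e}"

definition graph_iso :: "'a ugraph \<Rightarrow> 'b ugraph \<Rightarrow> bool" where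
  "graph_iso G H \<longleftrightarrow> (\<exists>f. bij_betw f (verts G) (verts H) \<and>
     (\<forall>u\<in>verts G. \<forall>v\<in>verts G. {u, v} \<in> edges G \<longleftrightarrow> {f u, f v} \<in> edges H))"

definition bipartite :: "'a ugraph \<Rightarrow> bool" where
  "bipartite G \<longleftrightarrow> (\<exists>X Y. X \<union> Y = verts G \<and> X \<inter> Y = {} \<and>
     (\<forall>e\<in>edges G. \<exists>x\<in>X. \<exists>y\<in>Y. e = {x, y}))"

text \<open>A cycle, and simple, only for \<open>k \<ge> 3\<close>.\<close>

definition cycle_graph :: "nat \<Rightarrow> nat ugraph" where
  "cycle_graph k = UGraph {..<k} {{i, Suc i mod k} | i. i < k}"

section \<open>Paths, connectivity and blocks\<close>

text \<open>Paths are given by their vertex lists, so a path with vertex list \<open>p\<close> has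
  \<open>length p - 1\<close> edges.\<close>

definition path_between :: "'a ugraph \<Rightarrow> 'a \<Rightarrow> 'a \<Rightarrow> 'a list \<Rightarrow> bool" where
  "path_between G a b p \<longleftrightarrow> p \<noteq> [] \<and> hd p = a \<and> last p = b \<and> distinct p \<and> set p \<subseteq> verts G \<and>
     successively (\<lambda>u v. {u, v} \<in> edges G) p"

definition connected_graph :: "'a ugraph \<Rightarrow> bool" where
  "connected_graph G \<longleftrightarrow> verts G \<noteq> {} \<and>
     (\<forall>a\<in>verts G. \<forall>b\<in>verts G. \<exists>p. path_between G a b p)"

text \<open>Deleting a cut-vertex separates two vertices that were joined before. With this reading
  the vertex of a one-vertex graph is not a cut-vertex.\<close>

definition cut_vertex :: "'a ugraph \<Rightarrow> 'a \<Rightarrow> bool" where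
  "cut_vertex G v \<longleftrightarrow> v \<in> verts G \<and>
     (\<exists>a\<in>verts G - {v}. \<exists>b\<in>verts G - {v}.
        (\<exists>p. path_between G a b p) \<and> (\<nexists>p. path_between (remove_vertex G v) a b p))"

definition two_connected :: "'a ugraph \<Rightarrow> bool" where
  "two_connected G \<longleftrightarrow> 3 \<le> card (verts G) \<and> connected_graph G \<and> (\<nexists>v. cut_vertex G v)"

definition block :: "'a ugraph \<Rightarrow> 'a ugraph \<Rightarrow> bool" where
  "block B G \<longleftrightarrow> subgraph B G \<and> connected_graph B \<and> (\<nexists>v. cut_vertex B v) \<and>
     (\<forall>H. subgraph H G \<and> connected_graph H \<and> (\<nexists>v. cut_vertex H v) \<and> subgraph B H \<longrightarrow> H = B)"

section \<open>Distance, Wiener index and Szeged index\<close>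

text \<open>Meaningful only when \<open>a\<close> and \<open>b\<close> are joined by a path.\<close>

definition gdist :: "'a ugraph \<Rightarrow> 'a \<Rightarrow> 'a \<Rightarrow> nat" where
  "gdist G a b = (LEAST k. \<exists>p. path_between G a b p \<and> length p = Suc k)"

definition closer :: "'a ugraph \<Rightarrow> 'a \<Rightarrow> 'a \<Rightarrow> nat" where
  "closer G a b = card {v \<in> verts G. gdist G v a < gdist G v b}"

text \<open>The value of a symmetric function on an unordered pair; see \<open>on_pair_eq\<close> below.\<close>

definition on_pair :: "('a \<Rightarrow> 'a \<Rightarrow> 'b) \<Rightarrow> 'a set \<Rightarrow> 'b" where
  "on_pair f P = (THE y. \<exists>a b. P = {a, b} \<and> y = f a b)"

definition wiener :: "'a ugraph \<Rightarrow> nat" where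
  "wiener G = (\<Sum>P | P \<subseteq> verts G \<and> card P = 2. on_pair (gdist G) P)"

definition szeged :: "'a ugraph \<Rightarrow> nat" where
  "szeged G = (\<Sum>e\<in>edges G. on_pair (\<lambda>a b. closer G a b * closer G b a) e)"

definition eta :: "'a ugraph \<Rightarrow> int" where
  "eta G = int (szeged G) - int (wiener G)"

lemma on_pair_eq:
  assumes "\<And>x y. f x y = f y x"
  shows "on_pair f {a, b} = f a b"
  unfolding on_pair_def
  by (rule the_equality) (use assms in \<open>auto simp: doubleton_eq_iff\<close>)

lemma path_between_rev:
  "path_between G a b p \<Longrightarrow> path_between G b a (rev p)"
  by (auto simp: path_between_def hd_rev last_rev insert_commute)

lemma gdist_commute: "gdist G a b = gdist G b a"
proof -
  have "(\<exists>p. path_between G a b p \<and> length p = Suc k) \<longleftrightarrow>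
        (\<exists>p. path_between G b a p \<and> length p = Suc k)" for k
    by (metis path_between_rev length_rev)
  then show ?thesis
    by (simp add: gdist_def)
qed

lemma on_pair_gdist: "on_pair (gdist G) {a, b} = gdist G a b"
  by (rule on_pair_eq) (rule gdist_commute)

lemma on_pair_closer:
  "on_pair (\<lambda>a b. closer G a b * closer G b a) {a, b} = closer G a b * closer G b a"
  by (rule on_pair_eq) (rule mult.commute)

end

theory Submission
  imports Defs
begin

text \<open>
  Call an edge \<open>ab\<close> good for \<open>(x, y)\<close> if \<open>x\<close> is closer to \<open>a\<close> and \<open>y\<close> is closer to \<open>b\<close>. Counting
  pairs of vertices per edge, \<open>2 \<eta>(G)\<close> is the sum over all ordered pairs \<open>(x, y)\<close> of the number of
  good edges minus \<open>d(x, y)\<close>; so it suffices that for every \<open>x\<close> the sum over \<open>y\<close> is at least \<open>8\<close>.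

  Edges of geodesics are good, so each block \<open>B\<close> contributes separately, and the contribution
  of \<open>B\<close> depends only on the vertex \<open>r\<close> of \<open>B\<close> through which \<open>x\<close> sees \<open>B\<close>. For a bipartite
  2-connected block it is at least \<open>4\<close>, and at least \<open>8\<close> unless \<open>B\<close> is a \<open>C\<^sub>4\<close>. If some vertex of \<open>B\<close>
  has distance at least \<open>3\<close> from \<open>r\<close>, this holds because \<open>(r, y)\<close> has at least \<open>2 d(r, y)\<close> good
  edges (every edge cut of \<open>B\<close> has size at least two) and the distances from \<open>r\<close> add up to at
  least \<open>8\<close>. Otherwise the edges at vertices \<open>u\<close> at distance \<open>2\<close> from \<open>r\<close>, of degree \<open>D u\<close> in
  \<open>B\<close>, already yield the lower bound given by the sum of \<open>(D u + 2) (D u - 1)\<close> over all such \<open>u\<close>.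
\<close>

section \<open>Walks, paths and distances\<close>

definition adj :: "'a ugraph \<Rightarrow> 'a \<Rightarrow> 'a \<Rightarrow> bool" where
  "adj G a b \<longleftrightarrow> {a, b} \<in> edges G"

lemma adj_commute: "adj G a b \<longleftrightarrow> adj G b a"
  by (simp add: adj_def insert_commute)

lemma adj_sym: "adj G a b \<Longrightarrow> adj G b a"
  by (simp add: adj_commute)

lemma adjD:
  assumes "simple_graph G" "adj G a b"
  shows "a \<in> verts G" "b \<in> verts G" "a \<noteq> b"
proof -
  have "{a, b} \<subseteq> verts G" "card {a, b} = 2"
    using assms unfolding simple_graph_def adj_def by blast+
  then show "a \<in> verts G" "b \<in> verts G" "a \<noteq> b"
    by auto
qed

lemma simple_edgeE:
  assumes "simple_graph G" "e \<in> edges G"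
  obtains a b where "e = {a, b}" "a \<in> verts G" "b \<in> verts G" "a \<noteq> b" "adj G a b"
proof -
  have "card e = 2"
    using assms unfolding simple_graph_def by blast
  then obtain a b where e: "e = {a, b}"
    by (auto simp: card_2_iff)
  then have "adj G a b"
    using assms(2) by (simp add: adj_def)
  then show ?thesis
    using that[OF e] adjD[OF assms(1) \<open>adj G a b\<close>] by simp
qed

lemma finite_edges: "simple_graph G \<Longrightarrow> finite (edges G)"
  by (rule finite_subset[of _ "Pow (verts G)"]) (auto simp: simple_graph_def)

lemma successively_relpowp:
  "p \<noteq> [] \<Longrightarrow> successively R p \<Longrightarrow> (R ^^ (length p - 1)) (hd p) (last p)"
proof (induction p rule: induct_list012)
  case (3 x y zs)
  then have "(R ^^ length zs) y (last (y # zs))" "R x y"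
    by auto
  then have "(R ^^ Suc (length zs)) x (last (y # zs))"
    by (metis relpowp_Suc_I2)
  then show ?case by simp
qed auto

lemma path_relpowp:
  "path_between G a b p \<Longrightarrow> (adj G ^^ (length p - 1)) a b"
  using successively_relpowp[of p "adj G"] unfolding path_between_def adj_def by blast

lemma path_between_prefix:
  assumes "path_between G a b (p @ w # q)"
  shows "path_between G a w (p @ [w])"
proof -
  have "hd (p @ [w]) = hd (p @ w # q)" by (cases p) auto
  then show ?thesis
    using assms by (auto simp: path_between_def successively_append_iff)
qed

lemma path_between_suffix:
  "path_between G a b (p @ w # q) \<Longrightarrow> path_between G w b (w # q)"
  by (auto simp: path_between_def successively_append_iff)

text \<open>Induction on the walk, extending the path by one vertex at a time. If the new vertex
  \<open>b\<close> already lies on the path, the path is cut off at \<open>b\<close>, which only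
  shortens it. This lets distances be bounded by relational powers of \<open>adj\<close>.\<close>

lemma relpowp_path:
  assumes "simple_graph G" "a \<in> verts G" "(adj G ^^ k) a b"
  shows "\<exists>p. path_between G a b p \<and> length p \<le> Suc k"
  using assms(3)
proof (induction k arbitrary: b)
  case 0
  then have "path_between G a b [a]"
    using assms(2) by (auto simp: path_between_def)
  then show ?case by force
next
  case (Suc k)
  then obtain c where "(adj G ^^ k) a c" and cb: "adj G c b"
    by (auto elim: relpowp_Suc_E)
  with Suc obtain p where p: "path_between G a c p" "length p \<le> Suc k"
    by blast
  show ?case
  proof (cases "b \<in> set p")
    case True
    then obtain p1 p2 where "p = p1 @ b # p2"
      by (meson split_list)
    then have "path_between G a b (p1 @ [b])"
      using p(1) path_between_prefix by metis
    moreover have "length (p1 @ [b]) \<le> Suc (Suc k)"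
      using p(2) \<open>p = _\<close> by simp
    ultimately show ?thesis by blast
  next
    case False
    then have "path_between G a b (p @ [b])"
      using p(1) cb adjD[OF assms(1) cb]
      by (auto simp: path_between_def successively_append_iff adj_def)
    then show ?thesis using p(2) by force
  qed
qed

lemma ex_path_iff:
  assumes "simple_graph G"
  shows "(\<exists>p. path_between G a b p) \<longleftrightarrow> a \<in> verts G \<and> (adj G)\<^sup>*\<^sup>* a b"
proof
  assume "\<exists>p. path_between G a b p"
  then obtain p where p: "path_between G a b p" by blast
  then have "a \<in> verts G"
    by (metis path_between_def hd_in_set subsetD)
  then show "a \<in> verts G \<and> (adj G)\<^sup>*\<^sup>* a b"
    using path_relpowp[OF p] relpowp_imp_rtranclp by metis
next
  assume "a \<in> verts G \<and> (adj G)\<^sup>*\<^sup>* a b"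
  then show "\<exists>p. path_between G a b p"
    using relpowp_path[OF assms] rtranclp_imp_relpowp by metis
qed

lemma gdist_le:
  assumes "simple_graph G" "a \<in> verts G" "(adj G ^^ k) a b"
  shows "gdist G a b \<le> k"
proof -
  obtain p where p: "path_between G a b p" "length p \<le> Suc k"
    using relpowp_path[OF assms] by blast
  then have "p \<noteq> []" by (auto simp: path_between_def)
  then obtain j where j: "length p = Suc j" by (cases p) auto
  then have "gdist G a b \<le> j"
    unfolding gdist_def by (intro Least_le) (use p(1) in blast)
  with j p(2) show ?thesis by simp
qed

lemma shortest_path:
  assumes "connected_graph G" "a \<in> verts G" "b \<in> verts G"
  obtains p where "path_between G a b p" "length p = Suc (gdist G a b)"
proof -
  obtain p where p: "path_between G a b p"
    using assms by (auto simp: connected_graph_def)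
  then have "p \<noteq> []" by (auto simp: path_between_def)
  then obtain j where "length p = Suc j" by (cases p) auto
  then have "\<exists>k p. path_between G a b p \<and> length p = Suc k"
    using p by blast
  then have "\<exists>p. path_between G a b p \<and> length p = Suc (gdist G a b)"
    unfolding gdist_def by (rule LeastI_ex)
  then show ?thesis using that by blast
qed

locale connected_simple_graph =
  fixes G :: "'a ugraph"
  assumes simple: "simple_graph G" and connected: "connected_graph G"
begin

abbreviation "d \<equiv> gdist G"

lemma finite_verts: "finite (verts G)"
  using simple by (simp add: simple_graph_def)

lemma relpowp_d: "a \<in> verts G \<Longrightarrow> b \<in> verts G \<Longrightarrow> (adj G ^^ d a b) a b"
  by (metis shortest_path[OF connected] path_relpowp diff_Suc_1)

lemma d_self: "a \<in> verts G \<Longrightarrow> d a a = 0"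
  using gdist_le[OF simple, of a 0 a] by simp

lemma d_eq_0_iff: "a \<in> verts G \<Longrightarrow> b \<in> verts G \<Longrightarrow> d a b = 0 \<longleftrightarrow> a = b"
  using relpowp_d[of a b] d_self by auto

lemma d_triangle:
  assumes "a \<in> verts G" "b \<in> verts G" "c \<in> verts G"
  shows "d a c \<le> d a b + d b c"
proof (rule gdist_le[OF simple assms(1)])
  show "(adj G ^^ (d a b + d b c)) a c"
    using relpowp_d assms by (auto simp: relpowp_add)
qed

lemma d_adj:
  assumes "adj G a b"
  shows "d a b = 1"
proof -
  have "d a b \<le> 1"
    using gdist_le[OF simple, of a 1 b] adjD[OF simple assms] assms unfolding relpowp_1 by simp
  moreover have "d a b \<noteq> 0"
    using d_eq_0_iff adjD[OF simple assms] by simp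
  ultimately show ?thesis by linarith
qed

lemma d_adj_le:
  assumes "adj G a b" "x \<in> verts G"
  shows "d x b \<le> d x a + 1"
  using d_triangle[of x a b] d_adj[OF assms(1)] adjD[OF simple assms(1)] assms(2) by simp

section \<open>Good edges and geodesics\<close>

definition good :: "'a \<Rightarrow> 'a \<Rightarrow> 'a set set" where
  "good x y = {e \<in> edges G. \<exists>a b. e = {a, b} \<and> d x a < d x b \<and> d y b < d y a}"

lemma finite_good: "finite (good x y)"
  using finite_edges[OF simple] by (simp add: good_def)

text \<open>A shortest walk is split before and after its step number \<open>i\<close>. The two
  pieces bound the distances from above, and the triangle inequality forces these bounds to be
  tight.\<close>

lemma geodesic_edge:
  assumes "x \<in> verts G" "y \<in> verts G" "i < d x y"
  shows "\<exists>a b. adj G a b \<and> d x a = i \<and> d x b = Suc i \<and> {a, b} \<in> good x y"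
proof -
  have "d x y = i + Suc (d x y - Suc i)"
    using assms(3) by simp
  then have "(adj G ^^ (i + Suc (d x y - Suc i))) x y"
    using relpowp_d[OF assms(1,2)] by simp
  then obtain a where a: "(adj G ^^ i) x a" "(adj G ^^ Suc (d x y - Suc i)) a y"
    unfolding relpowp_add by blast
  obtain b where "adj G a b" "(adj G ^^ (d x y - Suc i)) b y"
    using relpowp_Suc_D2[OF a(2)] by blast
  note ab = a(1) this
  have in_V: "a \<in> verts G" "b \<in> verts G"
    using adjD[OF simple ab(2)] by auto
  have "d x a \<le> i" "d b y \<le> d x y - Suc i"
    using gdist_le[OF simple] ab in_V assms by auto
  moreover have "d x y \<le> d x b + d b y" "d x y \<le> d x a + d a y"
    "d x b \<le> d x a + 1" "d y a \<le> d y b + 1"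
    using d_triangle d_adj_le ab(2) adj_commute in_V assms by metis+
  ultimately have *: "d x a = i" "d x b = Suc i" "d y b < d y a"
    using assms(3) gdist_commute[of G y a] gdist_commute[of G y b] by linarith+
  then have "{a, b} \<in> good x y"
    using ab(2) unfolding good_def adj_def by (intro CollectI conjI exI[of _ a] exI[of _ b]) auto
  with * ab(2) show ?thesis by blast
qed

end

section \<open>Inseparable graphs and blocks\<close>

text \<open>Reachability after deleting \<open>w\<close>. Being reflexive, it also holds trivially
  from \<open>w\<close> to itself, so the lemmas exclude \<open>w\<close> through
  \<open>verts H - {w}\<close>.\<close>

abbreviation avoid :: "'a ugraph \<Rightarrow> 'a \<Rightarrow> 'a \<Rightarrow> 'a \<Rightarrow> bool" where
  "avoid H w \<equiv> (adj (remove_vertex H w))\<^sup>*\<^sup>*"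

lemma adj_remove_vertex:
  "adj (remove_vertex H w) a b \<longleftrightarrow> adj H a b \<and> a \<noteq> w \<and> b \<noteq> w"
  by (auto simp: adj_def remove_vertex_def)

lemma simple_remove_vertex: "simple_graph H \<Longrightarrow> simple_graph (remove_vertex H w)"
  by (auto simp: simple_graph_def remove_vertex_def)

lemma avoid_imp_reach: "avoid H w a b \<Longrightarrow> (adj H)\<^sup>*\<^sup>* a b"
  by (erule rtranclp_mono[THEN predicate2D, rotated]) (auto simp: adj_remove_vertex)

lemma avoid_commute: "avoid H w a b \<longleftrightarrow> avoid H w b a"
  using symp_rtranclp[of "adj (remove_vertex H w)"] adj_commute unfolding symp_def by metis

lemma avoid_mono: "edges B \<subseteq> edges H \<Longrightarrow> avoid B w a b \<Longrightarrow> avoid H w a b"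
  by (erule rtranclp_mono[THEN predicate2D, rotated]) (auto simp: adj_def remove_vertex_def)

text \<open>The condition for which blocks are maximal. It has no lower bound on the size, so single
  vertices and single edges satisfy it.\<close>

definition inseparable :: "'a ugraph \<Rightarrow> bool" where
  "inseparable H \<longleftrightarrow> connected_graph H \<and> (\<nexists>v. cut_vertex H v)"

lemma inseparable_iff:
  assumes "simple_graph H"
  shows "inseparable H \<longleftrightarrow> verts H \<noteq> {} \<and> (\<forall>a\<in>verts H. \<forall>b\<in>verts H. (adj H)\<^sup>*\<^sup>* a b) \<and>
    (\<forall>w\<in>verts H. \<forall>a\<in>verts H - {w}. \<forall>b\<in>verts H - {w}. avoid H w a b)"
proof -
  have "verts (remove_vertex H w) = verts H - {w}" for w
    by (simp add: remove_vertex_def)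
  then show ?thesis
    unfolding inseparable_def connected_graph_def cut_vertex_def
      ex_path_iff[OF assms] ex_path_iff[OF simple_remove_vertex[OF assms]]
    by (simp; blast)
qed

lemma inseparable_avoid:
  assumes "simple_graph H" "inseparable H" "a \<in> verts H - {w}" "b \<in> verts H - {w}"
  shows "avoid H w a b"
proof (cases "w \<in> verts H")
  case True
  then show ?thesis using assms inseparable_iff[OF assms(1)] by blast
next
  case False
  then have "adj (remove_vertex H w) = adj H"
    using adjD[OF assms(1)] by (auto simp: adj_remove_vertex fun_eq_iff)
  then show ?thesis using assms inseparable_iff[OF assms(1)] by auto
qed

text \<open>After deletion of any \<open>w\<close>, every remaining vertex of \<open>H\<close>
  reaches what is left of \<open>B\<close>, which is still connected. Two distinct vertices
  \<open>u\<close>, \<open>v\<close> of \<open>B\<close> also give plain connectedness: a vertex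
  other than \<open>v\<close> reaches \<open>u\<close> even when \<open>v\<close> is deleted, and
  \<open>v\<close> reaches \<open>u\<close> inside \<open>B\<close>.\<close>

lemma inseparable_extend:
  assumes H: "simple_graph H" and B: "subgraph B H" "inseparable B"
    and uv: "u \<in> verts B" "v \<in> verts B" "u \<noteq> v"
    and ext: "\<And>w z. z \<in> verts H - {w} \<Longrightarrow> \<exists>y\<in>verts B - {w}. avoid H w z y"
  shows "inseparable H"
proof -
  have B': "simple_graph B" "edges B \<subseteq> edges H" "verts B \<subseteq> verts H"
    using B(1) by (auto simp: subgraph_def)
  have av: "avoid H w a b" if ab: "a \<in> verts H - {w}" "b \<in> verts H - {w}" for a b w
  proof -
    obtain a' b' where 1: "a' \<in> verts B - {w}" "avoid H w a a'" "b' \<in> verts B - {w}" "avoid H w b b'"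
      using ext[OF ab(1)] ext[OF ab(2)] by blast
    then have "avoid H w a' b'"
      using avoid_mono[OF B'(2)] inseparable_avoid[OF B'(1) B(2)] by blast
    then show ?thesis using 1 avoid_commute by (metis rtranclp_trans)
  qed
  have BH: "(adj H)\<^sup>*\<^sup>* a b" if "(adj B)\<^sup>*\<^sup>* a b" for a b
    using that by (rule rtranclp_mono[THEN predicate2D, rotated]) (use B'(2) in \<open>auto simp: adj_def\<close>)
  have to_u: "(adj H)\<^sup>*\<^sup>* a u" "(adj H)\<^sup>*\<^sup>* u a" if "a \<in> verts H" for a
  proof -
    have uv_reach: "(adj H)\<^sup>*\<^sup>* u v" "(adj H)\<^sup>*\<^sup>* v u"
      using B(2) uv BH unfolding inseparable_iff[OF B'(1)] by blast+
    have "avoid H v a u" "avoid H v u a" if "a \<noteq> v"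
      using av[of a v u] av[of u v a] \<open>a \<in> verts H\<close> that uv B'(3) by blast+
    then show "(adj H)\<^sup>*\<^sup>* a u" "(adj H)\<^sup>*\<^sup>* u a"
      using uv_reach avoid_imp_reach[of H v] by (cases "a = v"; simp)+
  qed
  have "(adj H)\<^sup>*\<^sup>* a b" if "a \<in> verts H" "b \<in> verts H" for a b
    using to_u that rtranclp_trans[of "adj H" a u b] by blast
  then show ?thesis
    using av B'(3) uv unfolding inseparable_iff[OF H] by blast
qed

section \<open>Consequences of the maximality of blocks\<close>

lemma block_alt:
  "block B G \<longleftrightarrow> subgraph B G \<and> inseparable B \<and>
    (\<forall>H. subgraph H G \<and> inseparable H \<and> subgraph B H \<longrightarrow> H = B)"
  unfolding block_def inseparable_def conj_assoc by (rule refl)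

text \<open>Adding to \<open>B\<close> a path between two of its vertices keeps it inseparable, so
  by maximality nothing new is added.\<close>

lemma block_absorbs_path:
  assumes G: "simple_graph G" and B: "block B G"
    and p: "path_between G u v p" and uv: "u \<in> verts B" "v \<in> verts B" "u \<noteq> v"
  shows "set p \<subseteq> verts B" "\<And>i. Suc i < length p \<Longrightarrow> adj B (p ! i) (p ! Suc i)"
proof -
  define H where
    "H = UGraph (verts B \<union> set p) (edges B \<union> {{p ! i, p ! Suc i} | i. Suc i < length p})"
  have vH: "verts H = verts B \<union> set p" and
    eH: "edges H = edges B \<union> {{p ! i, p ! Suc i} | i. Suc i < length p}"
    by (auto simp: H_def)
  have B': "simple_graph B" "verts B \<subseteq> verts G" "edges B \<subseteq> edges G" "inseparable B"
    using B by (auto simp: block_alt subgraph_def)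
  have p': "p \<noteq> []" "p ! 0 = u" "p ! (length p - 1) = v" "distinct p" "set p \<subseteq> verts G"
    using p by (auto simp: path_between_def hd_conv_nth last_conv_nth)
  have p_adj: "adj G (p ! i) (p ! Suc i)" if "Suc i < length p" for i
    using p that by (auto simp: path_between_def successively_conv_nth adj_def)
  have "finite (verts B)" "\<And>e. e \<in> edges B \<Longrightarrow> e \<subseteq> verts B \<and> card e = 2"
    using B'(1) by (auto simp: simple_graph_def)
  moreover have "p ! i \<noteq> p ! Suc i" if "Suc i < length p" for i
    using p_adj[OF that] adjD[OF G] by blast
  ultimately have H: "simple_graph H"
    unfolding simple_graph_def vH eH by fastforce
  have HG: "subgraph H G"
    using H B' p' p_adj by (auto simp: subgraph_def vH eH adj_def)
  have BH: "subgraph B H"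
    using B' by (auto simp: subgraph_def vH eH)
  have seg: "avoid H w (p ! i) (p ! j)"
    if "i \<le> j" "j < length p" "\<And>k. i \<le> k \<Longrightarrow> k \<le> j \<Longrightarrow> p ! k \<noteq> w" for i j w
    using that
  proof (induction j rule: dec_induct)
    case (step n)
    then have "adj H (p ! n) (p ! Suc n)" "p ! n \<noteq> w" "p ! Suc n \<noteq> w"
      by (auto simp: adj_def eH)
    then have "adj (remove_vertex H w) (p ! n) (p ! Suc n)"
      by (simp add: adj_remove_vertex)
    with step show ?case by (auto intro: rtranclp.rtrancl_into_rtrancl)
  qed auto
  have "inseparable H"
  proof (rule inseparable_extend[OF H BH B'(4) uv])
    fix w z assume z: "z \<in> verts H - {w}"
    show "\<exists>y\<in>verts B - {w}. avoid H w z y"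
    proof (cases "z \<in> verts B")
      case False
      then obtain i where i: "i < length p" "z = p ! i"
        using z by (auto simp: vH in_set_conv_nth)
      show ?thesis
      \<comment> \<open>A path visits \<open>w\<close> at most once. If \<open>w\<close> comes
        before \<open>z\<close>, the rest of the path leads from \<open>z\<close> to
        \<open>v\<close>; otherwise the path can be followed back from \<open>z\<close> to
        \<open>u\<close>.\<close>
      proof (cases "\<exists>k\<le>i. p ! k = w")
        case True
        then obtain k where k: "k \<le> i" "p ! k = w" by blast
        then have "k < i" using i z by (cases "k = i") auto
        then have notw: "p ! j \<noteq> w" if "i \<le> j" "j \<le> length p - 1" for j
          using k i p'(4) that by (auto simp: nth_eq_iff_index_eq)
        have "avoid H w z v"
          using seg[of i "length p - 1" w] notw i p'(3) by simp
        moreover have "v \<noteq> w"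
          using notw[of "length p - 1"] i p'(3) by simp
        ultimately show ?thesis using uv by blast
      next
        case False
        then have "avoid H w (p ! 0) (p ! i)"
          using i(1) by (intro seg) auto
        then have "avoid H w z u"
          unfolding i(2) p'(2) by (subst avoid_commute)
        moreover have "u \<noteq> w"
          using False p'(2) by blast
        ultimately show ?thesis using uv by blast
      qed
    qed (use z in blast)
  qed
  then have "H = B" using B HG BH unfolding block_alt by blast
  then have "verts B \<union> set p = verts B"
    "edges B \<union> {{p ! i, p ! Suc i} | i. Suc i < length p} = edges B"
    using vH eH by metis+
  then show "set p \<subseteq> verts B" "\<And>i. Suc i < length p \<Longrightarrow> adj B (p ! i) (p ! Suc i)"
    unfolding adj_def by blast+
qed

text \<open>A common edge provides two common vertices, and deleting one vertex leaves at least one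
  of them to link the two blocks. Their union is therefore inseparable and by maximality equals
  both.\<close>

lemma blocks_edge_disjoint:
  assumes G: "simple_graph G" and B: "block B1 G" "block B2 G" "B1 \<noteq> B2"
  shows "edges B1 \<inter> edges B2 = {}"
proof (rule ccontr)
  assume "edges B1 \<inter> edges B2 \<noteq> {}"
  then obtain e where e: "e \<in> edges B1" "e \<in> edges B2" by blast
  have B': "simple_graph B1" "inseparable B1" "simple_graph B2" "inseparable B2"
    "subgraph B1 G" "subgraph B2 G"
    using B by (auto simp: block_alt subgraph_def)
  obtain u v where uv: "e = {u, v}" "u \<in> verts B1" "v \<in> verts B1" "u \<noteq> v"
    using simple_edgeE[OF B'(1) e(1)] by metis
  have uv2: "u \<in> verts B2" "v \<in> verts B2"
    using e(2) uv(1) B'(3) by (auto simp: simple_graph_def)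
  define H where "H = UGraph (verts B1 \<union> verts B2) (edges B1 \<union> edges B2)"
  have H: "simple_graph H" "subgraph B1 H" "subgraph B2 H" "subgraph H G"
    using B' unfolding H_def by (auto simp: simple_graph_def subgraph_def)
  have "inseparable H"
  proof (rule inseparable_extend[OF H(1,2) B'(2) uv(2-4)])
    fix w z assume z: "z \<in> verts H - {w}"
    obtain y where y: "y \<in> verts B1 - {w}" "y \<in> verts B2 - {w}"
      using uv uv2 by (cases "u = w") auto
    show "\<exists>y\<in>verts B1 - {w}. avoid H w z y"
    proof (cases "z \<in> verts B1")
      case False
      then have "avoid B2 w z y"
        using z y(2) inseparable_avoid[OF B'(3,4)] by (auto simp: H_def)
      then have "avoid H w z y"
        by (rule avoid_mono[rotated]) (auto simp: H_def)
      then show ?thesis using y(1) by blast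
    qed (use z in blast)
  qed
  then have "H = B1" "H = B2"
    using B H unfolding block_alt by blast+
  with B(3) show False by simp
qed

section \<open>Bipartite two-connected blocks\<close>

lemma relpowp_alternating:
  assumes "\<And>a b. R a b \<Longrightarrow> c a \<noteq> c b" "(R ^^ k) u v"
  shows "even k \<longleftrightarrow> (c u :: bool) = c v"
  using assms(2)
proof (induction k arbitrary: v)
  case (Suc k)
  then obtain w where "(R ^^ k) u w" "R w v" by (auto elim: relpowp_Suc_E)
  with Suc.IH[of w] assms(1)[of w v] show ?case by auto
qed auto

lemma rtranclp_leaves_set:
  assumes "R\<^sup>*\<^sup>* u v" "u \<in> S" "v \<notin> S"
  shows "\<exists>a b. R a b \<and> a \<in> S \<and> b \<notin> S"
  using assms by (induction rule: rtranclp_induct) blast+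

text \<open>A two-connected block is described by its size alone, since \<open>block\<close> already
  contains connectedness and the absence of cut-vertices.\<close>

locale bipartite_block = connected_simple_graph G for G :: "'a ugraph" +
  fixes B :: "'a ugraph"
  assumes block: "block B G" and card_ge_3: "3 \<le> card (verts B)" and bipartite: "bipartite B"
begin

lemma simple_B: "simple_graph B" and verts_B: "verts B \<subseteq> verts G" and edges_B: "edges B \<subseteq> edges G"
  and inseparable_B: "inseparable B"
  using block by (auto simp: block_alt subgraph_def)

lemma in_G: "v \<in> verts B \<Longrightarrow> v \<in> verts G"
  using verts_B by blast

lemma finite_B: "finite (verts B)" "finite (edges B)"
  using simple_B finite_edges by (auto simp: simple_graph_def)

lemma adj_B_imp_G: "adj B a b \<Longrightarrow> adj G a b"
  using edges_B by (auto simp: adj_def)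

text \<open>Since all paths of \<open>G\<close> between vertices of \<open>B\<close> stay in
  \<open>B\<close>, the distance \<open>d\<close> of \<open>G\<close> agrees with the distance
  inside \<open>B\<close>; no separate metric on \<open>B\<close> is introduced.\<close>

lemma path_in_B:
  assumes "path_between G u v p" "u \<in> verts B" "v \<in> verts B"
  shows "path_between B u v p"
proof (cases "u = v")
  case True
  then have "p = [u]"
    using assms(1) by (cases p) (auto simp: path_between_def split: if_splits)
  then show ?thesis using assms True by (auto simp: path_between_def)
next
  case False
  then show ?thesis
    using block_absorbs_path[OF simple block assms False] assms
    by (auto simp: path_between_def successively_conv_nth adj_def)
qed

lemma relpowp_d_B:
  assumes "u \<in> verts B" "v \<in> verts B"
  shows "(adj B ^^ d u v) u v"
proof -
  obtain p where "path_between G u v p" "length p = Suc (d u v)"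
    using shortest_path[OF connected, of u v] assms in_G by metis
  then show ?thesis using path_relpowp[OF path_in_B] assms by fastforce
qed

lemma adj_B_if_d:
  assumes "u \<in> verts B" "v \<in> verts B" "d u v = 1"
  shows "adj B u v"
  using relpowp_d_B[OF assms(1,2)] assms(3) by (metis relpowp_1)

lemma ex_coloring: "\<exists>c :: 'a \<Rightarrow> bool. \<forall>a b. adj B a b \<longrightarrow> c a \<noteq> c b"
proof -
  obtain X Y where XY: "X \<inter> Y = {}" "\<forall>e\<in>edges B. \<exists>x\<in>X. \<exists>y\<in>Y. e = {x, y}"
    using bipartite by (auto simp: bipartite_def)
  have "(a \<in> X) \<noteq> (b \<in> X)" if "adj B a b" for a b
    using XY that unfolding adj_def by (fastforce simp: doubleton_eq_iff)
  then show ?thesis by (intro exI[of _ "\<lambda>a. a \<in> X"]) blast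
qed

definition side :: "'a \<Rightarrow> bool" where
  "side = (SOME c. \<forall>a b. adj B a b \<longrightarrow> c a \<noteq> c b)"

lemma side_adj: "adj B a b \<Longrightarrow> side a \<noteq> side b"
  using someI_ex[OF ex_coloring] unfolding side_def by blast

lemma even_d: "u \<in> verts B \<Longrightarrow> v \<in> verts B \<Longrightarrow> even (d u v) \<longleftrightarrow> side u = side v"
  by (rule relpowp_alternating[OF side_adj relpowp_d_B])

lemma adj_B_verts:
  assumes "adj B a b"
  shows "a \<in> verts B" "b \<in> verts B"
  using adjD[OF simple_B assms] by simp_all

text \<open>The two colour classes rule out equal distances from \<open>u\<close> to adjacent
  vertices, by parity.\<close>

lemma d_step:
  assumes "adj B a b" "u \<in> verts B"
  shows "d u b = Suc (d u a) \<or> d u a = Suc (d u b)"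
proof -
  have "even (d u a) \<noteq> even (d u b)"
    using even_d side_adj[OF assms(1)] adj_B_verts[OF assms(1)] assms(2) by auto
  moreover have "d u b \<le> d u a + 1" "d u a \<le> d u b + 1"
    using d_adj_le adj_B_imp_G[OF assms(1)] adj_commute in_G[OF assms(2)] by metis+
  ultimately show ?thesis by (cases "d u a = d u b") auto
qed

text \<open>The gate \<open>r\<close> is a vertex of \<open>B\<close> nearest to \<open>x\<close>.
  If a geodesic from \<open>x\<close> into \<open>B\<close> left the geodesic to \<open>r\<close>
  for good at \<open>w\<close>, the two remainders would form a path between vertices of
  \<open>B\<close>; it stays in \<open>B\<close>, so \<open>w\<close> lies in \<open>B\<close> and
  minimality gives \<open>w = r\<close>.\<close>

lemma gate:
  assumes "x \<in> verts G"
  shows "\<exists>r\<in>verts B. \<forall>v\<in>verts B. d x v = d x r + d r v"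
proof -
  have "verts B \<noteq> {}" using card_ge_3 by auto
  define r where "r = arg_min_on (d x) (verts B)"
  have rB: "r \<in> verts B" and r_min: "\<And>v. v \<in> verts B \<Longrightarrow> d x r \<le> d x v"
    unfolding r_def using finite_B \<open>verts B \<noteq> {}\<close>
    by (auto intro: arg_min_if_finite(1) arg_min_least)
  obtain s where s: "path_between G x r s" "length s = Suc (d x r)"
    using shortest_path[OF connected assms in_G[OF rB]] .
  have "d x v = d x r + d r v" if v: "v \<in> verts B" for v
  proof -
    obtain q where q: "path_between G x v q" "length q = Suc (d x v)"
      using shortest_path[OF connected assms in_G[OF v]] .
    have "x \<in> set s" "x \<in> set q"
      using s(1) q(1) hd_in_set unfolding path_between_def by metis+
    \<comment> \<open>Taking the last vertex of \<open>q\<close> on \<open>s\<close> makes the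
      reversed end of \<open>s\<close> and the tail of \<open>q\<close> disjoint, so that their
      concatenation is a path.\<close>
    then obtain q1 w q2 where q': "q = q1 @ w # q2" "w \<in> set s" "\<forall>z\<in>set q2. z \<notin> set s"
      using split_list_last_prop[of q "\<lambda>z. z \<in> set s"] by blast
    then obtain s1 s2 where s': "s = s1 @ w # s2"
      by (meson split_list)
    have ws: "path_between G w r (w # s2)"
      using s(1) s' path_between_suffix by metis
    have qw: "path_between G w v (w # q2)"
      using q(1) q'(1) path_between_suffix by metis
    have "hd (rev s2 @ w # q2) = hd (rev s2 @ [w])"
      by (cases "rev s2") auto
    then have "path_between G r v (rev (w # s2) @ q2)"
      using path_between_rev[OF ws] qw q'(3) s' unfolding path_between_def
      by (auto simp: successively_append_iff successively_Cons)
    then have "path_between B r v (rev (w # s2) @ q2)"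
      by (rule path_in_B[OF _ rB v])
    then have wB: "w \<in> verts B" by (auto simp: path_between_def)
    have sw: "path_between G x w (s1 @ [w])"
      using s(1) s' path_between_prefix by metis
    have "d x w \<le> length s1"
      using gdist_le[OF simple assms path_relpowp[OF sw]] by simp
    moreover have "length s1 + length s2 = d x r"
      using s(2) s' by simp
    ultimately have "length s2 = 0"
      using r_min[OF wB] by linarith
    then have "w = r"
      using ws by (simp add: path_between_def)
    have qr: "path_between G x w (q1 @ [w])"
      using q(1) q'(1) path_between_prefix by metis
    have "d x w \<le> length q1" "d w v \<le> length q2"
      using gdist_le[OF simple assms path_relpowp[OF qr]]
        gdist_le[OF simple in_G[OF wB] path_relpowp[OF qw]] by simp_all
    then have "d x r + d r v \<le> d x v"
      using q(2) q'(1) \<open>w = r\<close> by simp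
    then show ?thesis
      using d_triangle[OF assms in_G[OF rB] in_G[OF v]] by simp
  qed
  with rB show ?thesis by blast
qed

section \<open>Edge cuts and degrees inside the block\<close>

definition crossing :: "'a set \<Rightarrow> 'a set set" where
  "crossing S = {e \<in> edges B. \<exists>a b. e = {a, b} \<and> a \<in> S \<and> b \<notin> S}"

text \<open>Suppose \<open>ab\<close> were the only crossing edge, and take a third vertex
  \<open>z\<close>. If \<open>z\<close> is in \<open>S\<close>, a walk from \<open>z\<close> to
  \<open>b\<close> avoiding \<open>a\<close> must cross elsewhere; if not, so must a walk from
  \<open>a\<close> to \<open>z\<close> avoiding \<open>b\<close>.\<close>

lemma card_crossing:
  assumes "u \<in> verts B" "u \<in> S" "v \<in> verts B" "v \<notin> S"
  shows "2 \<le> card (crossing S)"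
proof (rule ccontr)
  assume "\<not> 2 \<le> card (crossing S)"
  then have le1: "card (crossing S) \<le> 1" by simp
  have fin: "finite (crossing S)"
    using finite_B by (simp add: crossing_def)
  have "(adj B)\<^sup>*\<^sup>* u v"
    using inseparable_B assms(1,3) unfolding inseparable_iff[OF simple_B] by simp
  then obtain a b where ab: "adj B a b" "a \<in> S" "b \<notin> S"
    using rtranclp_leaves_set[OF _ assms(2,4)] by blast
  then have "{a, b} \<in> crossing S"
    unfolding crossing_def adj_def by blast
  then have only: "e = {a, b}" if "e \<in> crossing S" for e
    using le1 fin that by (auto simp: card_le_Suc0_iff_eq)
  have "card {a, b} < card (verts B)"
    using card_ge_3 by (cases "a = b") auto
  then have "\<not> verts B \<subseteq> {a, b}"
    by (metis card_mono finite.emptyI finite.insertI not_less)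
  then obtain z where z: "z \<in> verts B" "z \<noteq> a" "z \<noteq> b" by blast
  have step: "\<not> (adj (remove_vertex B w) p q \<and> p \<in> S \<and> q \<notin> S)" if "w \<in> {a, b}" for w p q
  proof
    assume pq: "adj (remove_vertex B w) p q \<and> p \<in> S \<and> q \<notin> S"
    then have "{p, q} \<in> crossing S"
      unfolding crossing_def adj_remove_vertex unfolding adj_def by blast
    then show False
      using only[of "{p, q}"] pq that by (auto simp: adj_remove_vertex doubleton_eq_iff)
  qed
  note av = inseparable_avoid[OF simple_B inseparable_B]
  have "a \<in> verts B" "b \<in> verts B" "a \<noteq> b"
    using adjD[OF simple_B ab(1)] by auto
  then have "avoid B a z b" "avoid B b a z"
    using av[of z a b] av[of a b z] z by auto
  then show False
    using rtranclp_leaves_set[of "adj (remove_vertex B a)" z b S]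
      rtranclp_leaves_set[of "adj (remove_vertex B b)" a z S] step ab by blast
qed

definition nbrs :: "'a \<Rightarrow> 'a set" where
  "nbrs a = {b. adj B a b}"

lemma nbrs_sub: "nbrs a \<subseteq> verts B"
  using adj_B_verts by (auto simp: nbrs_def)

lemma finite_nbrs: "finite (nbrs a)"
  using nbrs_sub finite_B finite_subset by blast

text \<open>The cut bound for the singleton \<open>{a}\<close>.\<close>

lemma card_nbrs:
  assumes "a \<in> verts B"
  shows "2 \<le> card (nbrs a)"
proof -
  have "\<not> verts B \<subseteq> {a}"
    using card_ge_3 card_mono[of "{a}" "verts B"] by auto
  then obtain v where "v \<in> verts B" "v \<notin> {a}" by blast
  then have "2 \<le> card (crossing {a})"
    using card_crossing assms by blast
  also have "crossing {a} \<subseteq> (\<lambda>b. {a, b}) ` nbrs a"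
    by (auto simp: crossing_def nbrs_def adj_def)
  then have "card (crossing {a}) \<le> card (nbrs a)"
    using finite_nbrs by (meson card_image_le card_mono finite_imageI le_trans)
  finally show ?thesis .
qed

lemma two_nbrs:
  assumes "a \<in> verts B"
  obtains b c where "adj B a b" "adj B a c" "b \<noteq> c"
proof -
  obtain X where "X \<subseteq> nbrs a" "card X = 2"
    using card_nbrs[OF assms] by (meson obtain_subset_with_card_n)
  then show ?thesis using that by (auto simp: card_2_iff nbrs_def)
qed

text \<open>The function \<open>d x - d y\<close> moves by \<open>-2\<close>, \<open>0\<close> or \<open>2\<close> along an edge, the good edges
  being those where it moves; each of the \<open>d x y\<close> gaps between its values at \<open>x\<close> and \<open>y\<close>
  is crossed by at least two edges.\<close>

lemma card_good_ge_double:
  assumes x: "x \<in> verts B" and y: "y \<in> verts B"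
  shows "2 * d x y \<le> card (good x y \<inter> edges B)"
proof -
  define g :: "'a \<Rightarrow> int" where "g v = int (d x v) - int (d y v)" for v
  \<comment> \<open>For \<open>t < d x y\<close> the thresholds are \<open>- d x y\<close>,
    \<open>- d x y + 2\<close>, up to \<open>d x y - 2\<close>, so each \<open>S t\<close> contains
    \<open>x\<close> and not \<open>y\<close>.\<close>
  define S where "S t = {v. g v \<le> 2 * int t - int (d x y)}" for t
  have ends: "g x = - int (d x y)" "g y = int (d x y)"
    using d_self in_G x y gdist_commute[of G y x] by (simp_all add: g_def)
  have step: "\<bar>g a - g b\<bar> \<in> {0, 2} \<and> (g a < g b \<longrightarrow> d x a < d x b \<and> d y b < d y a)"
    if "adj B a b" for a b
    using d_step[OF that x] d_step[OF that y] unfolding g_def by auto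
  \<comment> \<open>An edge leaving \<open>S t\<close> raises \<open>g\<close> by exactly 2. This
    leaves two consecutive integers for \<open>g a\<close>, and these pairs are disjoint for
    different \<open>t\<close>; an edge thus belongs to one cut only.\<close>
  have cross: "{a, b} \<in> good x y \<and> g b = g a + 2 \<and> g a \<in> {2 * int t - int (d x y) - 1, 2 * int t - int (d x y)}"
    if "adj B a b" "a \<in> S t" "b \<notin> S t" for a b t
  proof -
    have "g a < g b" using that by (simp add: S_def)
    then have *: "d x a < d x b" "d y b < d y a" "g b = g a + 2"
      using step[OF that(1)] by auto
    moreover have "{a, b} \<in> good x y"
      using adj_B_imp_G[OF that(1)] *(1,2) unfolding good_def adj_def
      by (intro CollectI conjI exI[of _ a] exI[of _ b]) simp_all
    ultimately show ?thesis using that by (auto simp: S_def)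
  qed
  have crossE: "\<exists>a b. e = {a, b} \<and> adj B a b \<and> a \<in> S t \<and> b \<notin> S t" if "e \<in> crossing (S t)" for e t
    using that unfolding crossing_def adj_def by blast
  have "crossing (S t) \<subseteq> good x y \<inter> edges B" for t
    using crossE[of _ t] cross[of _ _ t] by (fastforce simp: crossing_def)
  moreover have "crossing (S t) \<inter> crossing (S t') = {}" if "t \<noteq> t'" for t t'
  proof (rule ccontr)
    assume "crossing (S t) \<inter> crossing (S t') \<noteq> {}"
    then obtain e where "e \<in> crossing (S t)" "e \<in> crossing (S t')" by blast
    then obtain a b a' b' where *: "e = {a, b}" "adj B a b" "a \<in> S t" "b \<notin> S t"
      "e = {a', b'}" "adj B a' b'" "a' \<in> S t'" "b' \<notin> S t'"
      using crossE by meson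
    note c = cross[OF *(2-4)] cross[OF *(6-8)]
    have "a = a'"
      using *(1,5) c by (auto simp: doubleton_eq_iff)
    then show False using c \<open>t \<noteq> t'\<close> by auto
  qed
  moreover have "finite (crossing S)" for S
    using finite_B by (simp add: crossing_def)
  ultimately have "card (\<Union>t<d x y. crossing (S t)) = (\<Sum>t<d x y. card (crossing (S t)))"
    and "card (\<Union>t<d x y. crossing (S t)) \<le> card (good x y \<inter> edges B)"
    using finite_B
    by (simp add: card_UN_disjoint)
      (meson UN_least card_mono finite_B(2) finite_Int
        \<open>\<And>t. crossing (S t) \<subseteq> good x y \<inter> edges B\<close>)
  moreover have "(\<Sum>t<d x y. 2) \<le> (\<Sum>t<d x y. card (crossing (S t)))"
    by (intro sum_mono card_crossing[OF x _ y]) (auto simp: S_def ends)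
  ultimately show ?thesis by simp
qed

section \<open>The contribution of the block seen from one of its vertices\<close>

definition excess :: "'a \<Rightarrow> 'a \<Rightarrow> int" where
  "excess r y = int (card (good r y \<inter> edges B)) - int (d r y)"

lemma excess_ge_d: "r \<in> verts B \<Longrightarrow> y \<in> verts B \<Longrightarrow> int (d r y) \<le> excess r y"
  using card_good_ge_double[of r y] by (simp add: excess_def)

text \<open>Let \<open>z\<close> be farthest from \<open>r\<close>, at distance
  \<open>M \<ge> 3\<close>. By maximality its neighbours have distance \<open>M - 1\<close>, and
  those of \<open>r\<close> have distance 1. Two of each together with \<open>z\<close> are five
  distinct vertices with distance sum \<open>3 * M\<close>, which is at least 9.\<close>

lemma excess_sum_far:
  assumes r: "r \<in> verts B" and far: "\<exists>z\<in>verts B. 3 \<le> d r z"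
  shows "8 \<le> (\<Sum>y\<in>verts B. excess r y)"
proof -
  define M where "M = Max (d r ` verts B)"
  have le_M: "d r v \<le> M" if "v \<in> verts B" for v
    unfolding M_def using finite_B that by simp
  have "M \<in> d r ` verts B"
    unfolding M_def using finite_B r by (intro Max_in) auto
  then obtain z where z: "z \<in> verts B" "d r z = M" by auto
  have M: "3 \<le> M" using far le_M by force
  have z_nbr: "v \<in> verts B \<and> d r v = M - 1" if "adj B z v" for v
    using d_step[OF that r] le_M[of v] adj_B_verts[OF that] z M by auto
  have r_nbr: "v \<in> verts B \<and> d r v = 1" if "adj B r v" for v
    using d_adj[OF adj_B_imp_G[OF that]] adj_B_verts[OF that] by simp
  obtain z1 z2 where z12: "adj B z z1" "adj B z z2" "z1 \<noteq> z2"
    using two_nbrs[OF z(1)] .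
  obtain r1 r2 where r12: "adj B r r1" "adj B r r2" "r1 \<noteq> r2"
    using two_nbrs[OF r] .
  note facts = z_nbr[OF z12(1)] z_nbr[OF z12(2)] r_nbr[OF r12(1)] r_nbr[OF r12(2)]
  have distinct: "z \<notin> {z1, z2, r1, r2}" "z1 \<notin> {z2, r1, r2}" "z2 \<notin> {r1, r2}" "r1 \<noteq> r2"
    using facts z M z12(3) r12(3) by auto
  then have "(\<Sum>y\<in>{z, z1, z2, r1, r2}. int (d r y)) = int M + 2 * int (M - 1) + 2"
    using facts z by simp
  then have "8 \<le> (\<Sum>y\<in>{z, z1, z2, r1, r2}. int (d r y))"
    using M by simp
  also have "\<dots> \<le> (\<Sum>y\<in>verts B. int (d r y))"
    using facts z finite_B by (intro sum_mono2) auto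
  also have "\<dots> \<le> (\<Sum>y\<in>verts B. excess r y)"
    using excess_ge_d[OF r] by (intro sum_mono)
  finally show ?thesis .
qed

lemma good_B_I:
  assumes "adj B a b" "d x a < d x b" "d y b < d y a"
  shows "{a, b} \<in> good x y \<inter> edges B"
  using assms adj_B_imp_G[OF assms(1)] unfolding good_def adj_def
  by (intro IntI CollectI conjI exI[of _ a] exI[of _ b]) simp_all

section \<open>Blocks with all vertices within distance two of \<open>r\<close>\<close>

context
  fixes r
  assumes r: "r \<in> verts B" and near: "\<And>z. z \<in> verts B \<Longrightarrow> d r z \<le> 2"
begin

definition level2 :: "'a set" where
  "level2 = {u \<in> verts B. d r u = 2}"

lemma finite_level2: "finite level2"
  using finite_B by (simp add: level2_def)

lemma nbrs_r: "nbrs r = {c \<in> verts B. d r c = 1}"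
  using d_adj[OF adj_B_imp_G] adj_B_verts adj_B_if_d[OF r] by (auto simp: nbrs_def)

lemma verts_levels: "verts B = insert r (nbrs r \<union> level2)"
proof -
  have "d r v = 0 \<or> d r v = 1 \<or> d r v = 2" if "v \<in> verts B" for v
    using near[OF that] by linarith
  moreover have "d r v = 0 \<longleftrightarrow> v = r" if "v \<in> verts B" for v
    using d_eq_0_iff in_G r that by auto
  ultimately show ?thesis
    using r unfolding nbrs_r level2_def by blast
qed

lemma level2_nbrs: "u \<in> level2 \<Longrightarrow> adj B u v \<Longrightarrow> v \<in> nbrs r"
  using d_step[of u v r] near[of v] adj_B_verts[of u v] r unfolding level2_def nbrs_r by auto

lemma level1_nbrs: "c \<in> nbrs r \<Longrightarrow> adj B c v \<Longrightarrow> v = r \<or> v \<in> level2"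
  using d_step[of c v r] adj_B_verts[of c v] r d_eq_0_iff[of r v] in_G
  unfolding level2_def nbrs_r by auto

lemma d_r_r: "d r r = 0"
  using d_self in_G r by blast

text \<open>Each neighbour \<open>c\<close> of \<open>u\<close> lies on a geodesic from
  \<open>r\<close> to \<open>u\<close>, so both \<open>rc\<close> and \<open>cu\<close> are good;
  the distance 2 is then subtracted.\<close>

lemma excess_level2:
  assumes u: "u \<in> level2"
  shows "2 * int (card (nbrs u)) - 2 \<le> excess r u"
proof -
  have u': "u \<in> verts B" "d r u = 2" "d u r = 2"
    using u gdist_commute[of G u r] by (auto simp: level2_def)
  have c: "c \<in> nbrs r" "adj B r c" "adj B c u" "d r c = 1" "d u c = 1" if "c \<in> nbrs u" for c
  proof -
    show "c \<in> nbrs r" using level2_nbrs[OF u] that by (simp add: nbrs_def)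
    then show "adj B r c" "d r c = 1" unfolding nbrs_r using adj_B_if_d[OF r] by auto
    show "adj B c u" "d u c = 1"
      using that d_adj[OF adj_B_imp_G] adj_sym[of B u c] by (auto simp: nbrs_def)
  qed
  have "r \<noteq> u" using u' d_r_r by auto
  have "r \<notin> nbrs u" "u \<notin> nbrs u"
    using c(4)[of r] c(4)[of u] d_r_r u' by auto
  then have "card ((\<lambda>c. {r, c}) ` nbrs u \<union> (\<lambda>c. {c, u}) ` nbrs u) = card (nbrs u) + card (nbrs u)"
    using finite_nbrs \<open>r \<noteq> u\<close>
    by (subst card_Un_disjoint) (auto simp: card_image inj_on_def doubleton_eq_iff)
  moreover have "(\<lambda>c. {r, c}) ` nbrs u \<union> (\<lambda>c. {c, u}) ` nbrs u \<subseteq> good r u \<inter> edges B"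
  proof -
    have "{r, c} \<in> good r u \<inter> edges B" "{c, u} \<in> good r u \<inter> edges B" if "c \<in> nbrs u" for c
      using c[OF that] u' d_r_r d_self[OF in_G[OF u'(1)]] by (intro good_B_I; simp)+
    then show ?thesis by blast
  qed
  ultimately have "card (nbrs u) + card (nbrs u) \<le> card (good r u \<inter> edges B)"
    using finite_B by (metis card_mono finite_Int)
  then show ?thesis using u' by (simp add: excess_def)
qed

text \<open>The good edge \<open>ry\<close> pays for \<open>d r y = 1\<close>. Every further edge
  \<open>cu\<close>, with \<open>u\<close> a common neighbour of \<open>y\<close> and
  \<open>c \<noteq> y\<close>, is good as well: \<open>r\<close> is closer to \<open>c\<close> and
  \<open>y\<close> is closer to \<open>u\<close>.\<close>

lemma excess_level1:
  assumes y: "y \<in> nbrs r"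
  shows "(\<Sum>u\<in>{u \<in> level2. y \<in> nbrs u}. int (card (nbrs u)) - 1) \<le> excess r y"
proof -
  let ?U = "{u \<in> level2. y \<in> nbrs u}"
  let ?E = "\<Union>u\<in>?U. (\<lambda>c. {c, u}) ` (nbrs u - {y})"
  have y': "y \<in> verts B" "d r y = 1" "d y r = 1" "adj B r y"
    using y gdist_commute[of G y r] unfolding nbrs_r using adj_B_if_d[OF r] by auto
  have edge: "{c, u} \<in> good r y \<inter> edges B" if u: "u \<in> ?U" and c: "c \<in> nbrs u - {y}" for u c
  proof -
    have "c \<in> nbrs r" using level2_nbrs[of u c] u c by (auto simp: nbrs_def)
    then have c': "c \<in> verts B" "d r c = 1" by (auto simp: nbrs_r)
    \<comment> \<open>Both are neighbours of \<open>u\<close>. Hence \<open>d y c\<close> is even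
      and nonzero, so at least 2.\<close>
    have "side c = side y"
      using side_adj[of u c] side_adj[of u y] u c by (auto simp: nbrs_def)
    then have "even (d y c)" "d y c \<noteq> 0"
      using even_d[of y c] y' c' c d_eq_0_iff in_G by auto
    then have "2 \<le> d y c" by presburger
    moreover have "d y u = 1"
      using d_adj[OF adj_B_imp_G[OF adj_sym[of B u y]]] u by (simp add: nbrs_def)
    ultimately show ?thesis
      using u c c' adj_sym[of B u c] by (intro good_B_I) (auto simp: nbrs_def level2_def)
  qed
  have "d y y = 0" using d_self in_G y' by blast
  then have ry: "{r, y} \<in> good r y \<inter> edges B"
    using y' d_r_r by (intro good_B_I) auto
  have not_ry: "{r, y} \<notin> ?E"
  proof
    assume "{r, y} \<in> ?E"
    then obtain u c where u: "u \<in> level2" and "{r, y} = {c, u}" by blast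
    then have "r = u \<or> y = u" by (auto simp: doubleton_eq_iff)
    then show False using u y' d_r_r by (auto simp: level2_def)
  qed
  have "card ?E = (\<Sum>u\<in>?U. card ((\<lambda>c. {c, u}) ` (nbrs u - {y})))"
  proof (rule card_UN_disjoint)
    show "\<forall>u\<in>?U. \<forall>v\<in>?U. u \<noteq> v \<longrightarrow>
      (\<lambda>c. {c, u}) ` (nbrs u - {y}) \<inter> (\<lambda>c. {c, v}) ` (nbrs v - {y}) = {}"
    \<comment> \<open>A shared edge would join the two level-2 vertices \<open>u\<close> and
      \<open>v\<close>, whose neighbours all lie in level 1.\<close>
    proof (intro ballI impI, rule ccontr)
      fix u v assume uv: "u \<in> ?U" "v \<in> ?U" "u \<noteq> v"
        and "(\<lambda>c. {c, u}) ` (nbrs u - {y}) \<inter> (\<lambda>c. {c, v}) ` (nbrs v - {y}) \<noteq> {}"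
      then have "v \<in> nbrs u" by (auto simp: doubleton_eq_iff)
      then have "v \<in> nbrs r" using level2_nbrs[of u v] uv by (auto simp: nbrs_def)
      then show False using uv by (auto simp: nbrs_r level2_def)
    qed
  qed (use finite_level2 finite_nbrs in auto)
  also have "\<dots> = (\<Sum>u\<in>?U. card (nbrs u - {y}))"
  proof (intro sum.cong refl card_image inj_onI)
    fix u c c' assume "{c, u} = {c', u}"
    then show "c = c'" by (auto simp: doubleton_eq_iff)
  qed
  also have "int \<dots> = (\<Sum>u\<in>?U. int (card (nbrs u)) - 1)"
    unfolding of_nat_sum
  proof (rule sum.cong[OF refl])
    fix u assume u: "u \<in> ?U"
    then have "0 < card (nbrs u)" using finite_nbrs by (auto simp: card_gt_0_iff)
    then show "int (card (nbrs u - {y})) = int (card (nbrs u)) - 1"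
      using u by (simp add: card_Diff_singleton of_nat_diff)
  qed
  finally have card_E: "int (card ?E) = (\<Sum>u\<in>?U. int (card (nbrs u)) - 1)" .
  have "finite ?E" using finite_level2 finite_nbrs by auto
  then have "Suc (card ?E) = card (insert {r, y} ?E)"
    using not_ry by simp
  also have "\<dots> \<le> card (good r y \<inter> edges B)"
    using finite_B ry edge by (intro card_mono) auto
  finally show ?thesis using card_E y' by (simp add: excess_def)
qed

text \<open>With \<open>D\<close> the degree of \<open>u\<close>, each of its \<open>D\<close>
  neighbours receives \<open>D - 1\<close> on account of \<open>u\<close>, by exchanging the sums
  over levels 1 and 2. The vertex \<open>u\<close> itself adds \<open>2 * D - 2\<close>, which makes
  \<open>(D + 2) * (D - 1)\<close>.\<close>

lemma excess_sum_near:
  "(\<Sum>u\<in>level2. (int (card (nbrs u)) + 2) * (int (card (nbrs u)) - 1)) \<le> (\<Sum>y\<in>verts B. excess r y)"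
proof -
  have "(\<Sum>y\<in>nbrs r. \<Sum>u\<in>{u \<in> level2. y \<in> nbrs u}. int (card (nbrs u)) - 1) =
    (\<Sum>u\<in>level2. \<Sum>y\<in>{y \<in> nbrs r. y \<in> nbrs u}. int (card (nbrs u)) - 1)"
    by (rule sum.swap_restrict[OF finite_nbrs finite_level2])
  also have "\<dots> = (\<Sum>u\<in>level2. int (card (nbrs u)) * (int (card (nbrs u)) - 1))"
  proof (rule sum.cong[OF refl])
    fix u assume "u \<in> level2"
    then have "{y \<in> nbrs r. y \<in> nbrs u} = nbrs u"
      using level2_nbrs[of u] by (auto simp: nbrs_def)
    then show "(\<Sum>y\<in>{y \<in> nbrs r. y \<in> nbrs u}. int (card (nbrs u)) - 1) =
      int (card (nbrs u)) * (int (card (nbrs u)) - 1)" by simp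
  qed
  finally have "(\<Sum>u\<in>level2. int (card (nbrs u)) * (int (card (nbrs u)) - 1)) \<le> (\<Sum>y\<in>nbrs r. excess r y)"
    using sum_mono[OF excess_level1, of "nbrs r" "\<lambda>y. y"] by simp
  moreover have "(\<Sum>u\<in>level2. 2 * int (card (nbrs u)) - 2) \<le> (\<Sum>u\<in>level2. excess r u)"
    by (intro sum_mono excess_level2)
  moreover have "(\<Sum>u\<in>level2. (int (card (nbrs u)) + 2) * (int (card (nbrs u)) - 1)) =
    (\<Sum>u\<in>level2. int (card (nbrs u)) * (int (card (nbrs u)) - 1)) + (\<Sum>u\<in>level2. 2 * int (card (nbrs u)) - 2)"
    by (simp add: sum.distrib[symmetric] algebra_simps)
  moreover have "(\<Sum>y\<in>verts B. excess r y) = excess r r + (\<Sum>y\<in>nbrs r. excess r y) + (\<Sum>y\<in>level2. excess r y)"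
  proof -
    have "nbrs r \<inter> level2 = {}" "r \<notin> nbrs r \<union> level2"
      using d_r_r unfolding nbrs_r level2_def by auto
    then show ?thesis
      unfolding verts_levels using finite_nbrs finite_level2 by (simp add: sum.union_disjoint)
  qed
  moreover have "0 \<le> excess r r"
    using d_r_r by (simp add: excess_def)
  ultimately show ?thesis by linarith
qed

text \<open>A neighbour of \<open>r\<close> has a second neighbour, which can only lie in level
  2.\<close>

lemma level2_nonempty: "level2 \<noteq> {}"
proof -
  obtain c where c: "adj B r c" using two_nbrs[OF r] by metis
  then have "c \<in> nbrs r" by (simp add: nbrs_def)
  obtain v w where "adj B c v" "adj B c w" "v \<noteq> w"
    using two_nbrs adj_B_verts[OF c] by metis
  then show ?thesis using level1_nbrs[OF \<open>c \<in> nbrs r\<close>] by blast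
qed

text \<open>A neighbour of \<open>r\<close> has at least two neighbours, and only \<open>r\<close>
  and \<open>u\<close> are available. So \<open>r\<close> and \<open>u\<close> have the same two
  neighbours, and there are no other vertices.\<close>

lemma C4_if_small:
  assumes u: "level2 = {u}" and two: "card (nbrs u) = 2"
  shows "graph_iso B (cycle_graph 4)"
proof -
  obtain c1 c2 where c: "nbrs u = {c1, c2}" "c1 \<noteq> c2"
    using two by (auto simp: card_2_iff)
  have "nbrs r \<subseteq> nbrs u"
  proof
    fix c assume cr: "c \<in> nbrs r"
    then have "c \<in> verts B" using nbrs_sub by blast
    then obtain v w where vw: "adj B c v" "adj B c w" "v \<noteq> w"
      using two_nbrs by metis
    have "v = r \<or> v = u" "w = r \<or> w = u"
      using level1_nbrs[OF cr vw(1)] level1_nbrs[OF cr vw(2)] u by simp_all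
    then have "adj B c u" using vw by auto
    then show "c \<in> nbrs u" unfolding nbrs_def by (auto intro: adj_sym)
  qed
  moreover have "nbrs u \<subseteq> nbrs r"
    using level2_nbrs[of u] u by (auto simp: nbrs_def)
  ultimately have nr: "nbrs r = {c1, c2}" using c(1) by blast
  have V: "verts B = {r, c1, u, c2}"
    using verts_levels nr u by auto
  have "r \<noteq> u" using d_r_r u by (auto simp: level2_def)
  have A: "adj B r c1" "adj B r c2" "adj B u c1" "adj B u c2"
    using c nr by (auto simp: nbrs_def)
  have N: "\<not> adj B r u" "\<not> adj B c1 c2"
    using side_adj A by metis+
  have ne: "r \<noteq> c1" "r \<noteq> c2" "u \<noteq> c1" "u \<noteq> c2"
    using A side_adj by metis+
  have loop: "{a} \<notin> edges B" for a
    using adjD(3)[OF simple_B, of a a] by (auto simp: adj_def)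
  \<comment> \<open>The vertices are numbered in the cyclic order \<open>r\<close>,
    \<open>c1\<close>, \<open>u\<close>, \<open>c2\<close>.\<close>
  let ?f = "\<lambda>v. if v = r then 0 else if v = c1 then 1 else if v = u then 2 else (3::nat)"
  have "{..<4::nat} = {0, 1, 2, 3}" by auto
  then have bij: "bij_betw ?f (verts B) (verts (cycle_graph 4))"
    using c(2) ne \<open>r \<noteq> u\<close> unfolding V cycle_graph_def
    by (auto simp: bij_betw_def inj_on_def)
  have "edges (cycle_graph 4) = {{0, 1}, {1, 2}, {2, 3}, {3, 0}}"
  proof -
    have "edges (cycle_graph 4) = (\<lambda>i. {i, Suc i mod 4}) ` {..<4}"
      by (auto simp: cycle_graph_def)
    also have "\<dots> = {{0, 1}, {1, 2}, {2, 3}, {3, 0}}"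
      unfolding \<open>{..<4::nat} = {0, 1, 2, 3}\<close> by (simp flip: numeral_2_eq_2)
    finally show ?thesis .
  qed
  then have "\<forall>a\<in>verts B. \<forall>b\<in>verts B. {a, b} \<in> edges B \<longleftrightarrow> {?f a, ?f b} \<in> edges (cycle_graph 4)"
    using A N c(2) ne \<open>r \<noteq> u\<close> loop unfolding V adj_def
    by (simp add: doubleton_eq_iff insert_commute)
  with bij show ?thesis unfolding graph_iso_def by blast
qed

end

text \<open>In the near case every \<open>u\<close> in level 2 has degree at least 2 and yields at
  least 4, so two such vertices give 8. A single one of degree at least 3 gives 10, and a single one
  of degree 2 forces a four-cycle.\<close>

lemma excess_sum:
  assumes r: "r \<in> verts B"
  shows "(\<Sum>y\<in>verts B. excess r y) \<ge> (if graph_iso B (cycle_graph 4) then 4 else 8)"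
proof (cases "\<exists>z\<in>verts B. 3 \<le> d r z")
  case True
  then show ?thesis using excess_sum_far[OF r] by simp
next
  case False
  then have near: "d r z \<le> 2" if "z \<in> verts B" for z using that by force
  let ?L = "level2 r"
  let ?f = "\<lambda>u. (int (card (nbrs u)) + 2) * (int (card (nbrs u)) - 1)"
  have f: "4 \<le> ?f u" if "u \<in> ?L" for u
  proof -
    have "2 \<le> card (nbrs u)"
      using card_nbrs that level2_def[OF r near] by auto
    then have "4 * 1 \<le> ?f u" by (intro mult_mono) auto
    then show ?thesis by simp
  qed
  have total: "(\<Sum>u\<in>?L. ?f u) \<le> (\<Sum>y\<in>verts B. excess r y)"
    by (rule excess_sum_near[OF r near])
  have "int (card ?L) * 4 \<le> (\<Sum>u\<in>?L. ?f u)"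
    using f by (rule sum_bounded_below)
  moreover have "card ?L \<noteq> 0"
    using level2_nonempty[OF r near] finite_level2[OF r near] by simp
  moreover have "graph_iso B (cycle_graph 4) \<or> 8 \<le> (\<Sum>u\<in>?L. ?f u)" if "card ?L = 1"
  proof -
    obtain u where u: "?L = {u}" using \<open>card ?L = 1\<close> by (rule card_1_singletonE)
    show ?thesis
    proof (cases "card (nbrs u) = 2")
      case True
      then show ?thesis using C4_if_small[OF r near u] by blast
    next
      case False
      have "2 \<le> card (nbrs u)"
        using card_nbrs u level2_def[OF r near] by auto
      then have "3 \<le> card (nbrs u)" using False by simp
      then have "5 * 2 \<le> ?f u" by (intro mult_mono) auto
      then show ?thesis using u by simp
    qed
  qed
  ultimately show ?thesis using total by (cases "card ?L = 1") auto
qed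

text \<open>The witness \<open>m\<close> is the distance from \<open>x\<close> to its gate
  \<open>r\<close>. Along edges of \<open>B\<close>, distances from \<open>x\<close> and from
  \<open>r\<close> differ by this constant, so the same edges are good and \<open>d x y - m\<close>
  is \<open>d r y\<close>.\<close>

lemma good_sum:
  assumes x: "x \<in> verts G"
  shows "\<exists>m. (\<forall>v\<in>verts B. m \<le> d x v) \<and>
    (if graph_iso B (cycle_graph 4) then 4 else 8) \<le>
    (\<Sum>y\<in>verts B. int (card (good x y \<inter> edges B)) - (int (d x y) - int m))"
proof -
  obtain r where r: "r \<in> verts B" "\<And>v. v \<in> verts B \<Longrightarrow> d x v = d x r + d r v"
    using gate[OF x] by blast
  have "good x y \<inter> edges B = good r y \<inter> edges B" for y
  proof -
    have "d x a < d x b \<longleftrightarrow> d r a < d r b" if "{a, b} \<in> edges B" for a b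
      using r(2)[of a] r(2)[of b] adj_B_verts[of a b] that by (simp add: adj_def)
    then show ?thesis by (auto simp: good_def)
  qed
  then have "(\<Sum>y\<in>verts B. int (card (good x y \<inter> edges B)) - (int (d x y) - int (d x r))) =
    (\<Sum>y\<in>verts B. excess r y)"
    using r(2) by (intro sum.cong) (simp_all add: excess_def)
  then show ?thesis
    using excess_sum[OF r(1)] r(2) by (intro exI[of _ "d x r"]) simp
qed

end

section \<open>The Szeged and Wiener indices as sums over pairs of vertices\<close>

context connected_simple_graph
begin

lemma in_good_iff:
  assumes "{a, b} \<in> edges G"
  shows "{a, b} \<in> good x y \<longleftrightarrow>
    (d x a < d x b \<and> d y b < d y a) \<or> (d x b < d x a \<and> d y a < d y b)"
  using assms by (auto simp: good_def doubleton_eq_iff)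

text \<open>Double counting: an edge \<open>ab\<close> is good for the ordered pairs with one vertex
  on the \<open>a\<close> side and one on the \<open>b\<close> side, in either order. This explains
  the factor 2.\<close>

lemma szeged_eq: "2 * szeged G = (\<Sum>x\<in>verts G. \<Sum>y\<in>verts G. card (good x y))"
proof -
  let ?V = "verts G"
  have "(\<Sum>x\<in>?V. \<Sum>y\<in>?V. card (good x y)) = (\<Sum>z\<in>?V \<times> ?V. card (good (fst z) (snd z)))"
    by (simp add: sum.cartesian_product case_prod_beta)
  also have "\<dots> = (\<Sum>z\<in>?V \<times> ?V. \<Sum>e\<in>{e \<in> edges G. e \<in> good (fst z) (snd z)}. 1)"
  proof (rule sum.cong[OF refl])
    fix z
    have "{e \<in> edges G. e \<in> good (fst z) (snd z)} = good (fst z) (snd z)"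
      by (auto simp: good_def)
    then show "card (good (fst z) (snd z)) = (\<Sum>e\<in>{e \<in> edges G. e \<in> good (fst z) (snd z)}. 1)"
      by simp
  qed
  also have "\<dots> = (\<Sum>e\<in>edges G. \<Sum>z\<in>{z \<in> ?V \<times> ?V. e \<in> good (fst z) (snd z)}. 1)"
    using finite_verts finite_edges[OF simple] by (intro sum.swap_restrict) auto
  also have "\<dots> = (\<Sum>e\<in>edges G. 2 * on_pair (\<lambda>a b. closer G a b * closer G b a) e)"
  proof (rule sum.cong[OF refl])
    fix e assume e: "e \<in> edges G"
    then obtain a b where ab: "e = {a, b}" using simple_edgeE[OF simple] by metis
    let ?A = "{v \<in> ?V. d v a < d v b}" and ?B = "{v \<in> ?V. d v b < d v a}"
    have "{z \<in> ?V \<times> ?V. e \<in> good (fst z) (snd z)} = ?A \<times> ?B \<union> ?B \<times> ?A"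
      using in_good_iff e unfolding ab by auto
    moreover have "card (?A \<times> ?B \<union> ?B \<times> ?A) = card (?A \<times> ?B) + card (?B \<times> ?A)"
      using finite_verts by (intro card_Un_disjoint) auto
    ultimately show "(\<Sum>z\<in>{z \<in> ?V \<times> ?V. e \<in> good (fst z) (snd z)}. 1) =
      2 * on_pair (\<lambda>a b. closer G a b * closer G b a) e"
      unfolding ab on_pair_closer by (simp add: closer_def card_cartesian_product)
  qed
  finally show ?thesis by (simp add: szeged_def sum_distrib_left)
qed

lemma wiener_eq: "2 * wiener G = (\<Sum>x\<in>verts G. \<Sum>y\<in>verts G. d x y)"
proof -
  let ?V = "verts G"
  let ?S = "{z \<in> ?V \<times> ?V. fst z \<noteq> snd z}" and ?T = "{P. P \<subseteq> ?V \<and> card P = 2}"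
  let ?g = "\<lambda>z::'a \<times> 'a. {fst z, snd z}"
  have "(\<Sum>x\<in>?V. \<Sum>y\<in>?V. d x y) = (\<Sum>z\<in>?V \<times> ?V. d (fst z) (snd z))"
    by (simp add: sum.cartesian_product case_prod_beta)
  also have "\<dots> = (\<Sum>z\<in>?S. d (fst z) (snd z))"
    using finite_verts d_self by (intro sum.mono_neutral_right) auto
  also have "\<dots> = (\<Sum>P\<in>?T. \<Sum>z\<in>{z \<in> ?S. ?g z = P}. d (fst z) (snd z))"
    using finite_verts by (intro sum.group[symmetric]) auto
  also have "\<dots> = (\<Sum>P\<in>?T. 2 * on_pair (gdist G) P)"
  proof (rule sum.cong[OF refl])
    fix P assume "P \<in> ?T"
    then obtain a b where ab: "P = {a, b}" "a \<noteq> b" "a \<in> ?V" "b \<in> ?V"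
      by (auto simp: card_2_iff)
    then have "{z \<in> ?S. ?g z = P} = {(a, b), (b, a)}"
      by (auto simp: doubleton_eq_iff)
    then show "(\<Sum>z\<in>{z \<in> ?S. ?g z = P}. d (fst z) (snd z)) = 2 * on_pair (gdist G) P"
      using ab(2) gdist_commute[of G b a] unfolding ab(1) on_pair_gdist by simp
  qed
  finally show ?thesis by (simp add: wiener_def sum_distrib_left)
qed

lemma eta_eq:
  "2 * eta G = (\<Sum>x\<in>verts G. \<Sum>y\<in>verts G. int (card (good x y)) - int (d x y))"
proof -
  have "2 * eta G = int (2 * szeged G) - int (2 * wiener G)"
    by (simp add: eta_def)
  then show ?thesis
    unfolding szeged_eq wiener_eq by (simp add: sum_subtractf)
qed

section \<open>Adding up the contributions of edge-disjoint blocks\<close>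

text \<open>A geodesic from \<open>x\<close> to \<open>y\<close> consists of good edges, and at most \<open>d x y - m B\<close> of them
  lie in \<open>B\<close>; the remaining ones supplement the good edges inside the given subgraphs.\<close>

lemma good_excess_ge:
  assumes x: "x \<in> verts G" and y: "y \<in> verts G" and fin: "finite \<B>"
    and simp_B: "\<And>B. B \<in> \<B> \<Longrightarrow> simple_graph B"
    and disj: "\<And>B B'. B \<in> \<B> \<Longrightarrow> B' \<in> \<B> \<Longrightarrow> B \<noteq> B' \<Longrightarrow> edges B \<inter> edges B' = {}"
    and m: "\<And>B v. B \<in> \<B> \<Longrightarrow> v \<in> verts B \<Longrightarrow> m B \<le> d x v"
  shows "(\<Sum>B\<in>{B \<in> \<B>. y \<in> verts B}. int (card (good x y \<inter> edges B)) - (int (d x y) - int (m B)))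
    \<le> int (card (good x y)) - int (d x y)"
proof -
  let ?Y = "{B \<in> \<B>. y \<in> verts B}"
  let ?F = "\<Union>B\<in>?Y. edges B"
  have "\<forall>i. \<exists>a b. i < d x y \<longrightarrow> d x a = i \<and> d x b = Suc i \<and> {a, b} \<in> good x y"
    using geodesic_edge[OF x y] by blast
  then obtain a b where ab: "\<And>i. i < d x y \<Longrightarrow> d x (a i) = i \<and> d x (b i) = Suc i \<and> {a i, b i} \<in> good x y"
    by metis
  define e where "e i = {a i, b i}" for i
  \<comment> \<open>The ends of \<open>e i\<close> have distances \<open>i\<close> and
    \<open>Suc i\<close> from \<open>x\<close>, so the edges chosen for different \<open>i\<close>
    differ.\<close>
  have inj: "inj_on e {..<d x y}"
  proof (rule inj_onI)
    fix i j assume ij: "i \<in> {..<d x y}" "j \<in> {..<d x y}" and "e i = e j"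
    then have "d x (a i) = d x (a j) \<or> d x (a i) = d x (b j) \<and> d x (b i) = d x (a j)"
      unfolding e_def doubleton_eq_iff by metis
    then show "i = j" using ab[of i] ab[of j] ij by auto
  qed
  let ?I = "{i \<in> {..<d x y}. e i \<in> ?F}" and ?J = "{i \<in> {..<d x y}. e i \<notin> ?F}"
  have "card ?I \<le> (\<Sum>B\<in>?Y. card {i \<in> {..<d x y}. e i \<in> edges B})"
  proof -
    have "?I = (\<Union>B\<in>?Y. {i \<in> {..<d x y}. e i \<in> edges B})" by blast
    then show ?thesis using card_UN_le[of ?Y] fin by simp
  qed
  also have "\<dots> \<le> (\<Sum>B\<in>?Y. d x y - m B)"
  proof (rule sum_mono)
    fix B assume B: "B \<in> ?Y"
    \<comment> \<open>The near end \<open>a i\<close> of an edge in \<open>B\<close> is a vertex of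
      \<open>B\<close>, so its distance \<open>i\<close> is at least \<open>m B\<close>.\<close>
    have "{i \<in> {..<d x y}. e i \<in> edges B} \<subseteq> {m B..<d x y}"
    proof
      fix i assume i: "i \<in> {i \<in> {..<d x y}. e i \<in> edges B}"
      then have "a i \<in> verts B"
        using simp_B[of B] B by (auto simp: simple_graph_def e_def)
      then have "m B \<le> i" using m[of B "a i"] ab[of i] B i by auto
      then show "i \<in> {m B..<d x y}" using i by simp
    qed
    then show "card {i \<in> {..<d x y}. e i \<in> edges B} \<le> d x y - m B"
      using card_mono[of "{m B..<d x y}"] by fastforce
  qed
  finally have "int (card ?I) \<le> int (\<Sum>B\<in>?Y. d x y - m B)"
    by (rule of_nat_mono)
  \<comment> \<open>The natural subtraction is exact: \<open>y\<close> is itself a vertex of each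
    \<open>B\<close> in \<open>?Y\<close>, so \<open>m B \<le> d x y\<close>.\<close>
  also have "\<dots> = (\<Sum>B\<in>?Y. int (d x y) - int (m B))"
    unfolding of_nat_sum using m by (intro sum.cong) (auto simp: of_nat_diff)
  finally have I: "int (card ?I) \<le> (\<Sum>B\<in>?Y. int (d x y) - int (m B))" .
  have "card ?I + card ?J = card (?I \<union> ?J)"
    by (rule card_Un_disjoint[symmetric]) auto
  also have "?I \<union> ?J = {..<d x y}" by blast
  finally have IJ: "card ?I + card ?J = d x y" by simp
  \<comment> \<open>Good edges inside the chosen subgraphs and geodesic edges outside them are
    disjoint sets of good edges.\<close>
  have "card (good x y \<inter> ?F) + card (e ` ?J) = card ((good x y \<inter> ?F) \<union> e ` ?J)"
    using finite_good by (intro card_Un_disjoint[symmetric]) auto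
  also have "\<dots> \<le> card (good x y)"
    using finite_good ab by (intro card_mono) (auto simp: e_def)
  finally have "card (good x y \<inter> ?F) + card (e ` ?J) \<le> card (good x y)" .
  moreover have "card (e ` ?J) = card ?J"
    using inj by (intro card_image inj_on_subset[OF inj]) auto
  moreover have "card (good x y \<inter> ?F) = (\<Sum>B\<in>?Y. card (good x y \<inter> edges B))"
  proof -
    have "good x y \<inter> ?F = (\<Union>B\<in>?Y. good x y \<inter> edges B)" by blast
    moreover have "card (\<Union>B\<in>?Y. good x y \<inter> edges B) = (\<Sum>B\<in>?Y. card (good x y \<inter> edges B))"
    proof (rule card_UN_disjoint)
      show "\<forall>B\<in>?Y. \<forall>B'\<in>?Y. B \<noteq> B' \<longrightarrow> good x y \<inter> edges B \<inter> (good x y \<inter> edges B') = {}"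
        using disj by blast
    qed (use fin finite_good in auto)
    ultimately show ?thesis by simp
  qed
  ultimately have "(\<Sum>B\<in>?Y. int (card (good x y \<inter> edges B))) + int (d x y)
      \<le> int (card (good x y)) + int (card ?I)"
    using IJ by (simp flip: of_nat_sum)
  then show ?thesis using I by (simp add: sum_subtractf)
qed

text \<open>Distinct blocks share no edges, so for each \<open>y\<close> the contributions of the
  blocks containing \<open>y\<close> add up. Exchanging the sums over \<open>y\<close> and over
  blocks then gives the total for \<open>x\<close>.\<close>

lemma vertex_excess_ge:
  assumes x: "x \<in> verts G" and fin: "finite \<B>"
    and blocks: "\<And>B. B \<in> \<B> \<Longrightarrow> block B G \<and> two_connected B \<and> bipartite B"
  shows "(\<Sum>B\<in>\<B>. if graph_iso B (cycle_graph 4) then 4 else 8)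
    \<le> (\<Sum>y\<in>verts G. int (card (good x y)) - int (d x y))"
proof -
  have bb: "bipartite_block G B" if "B \<in> \<B>" for B
    using blocks[OF that] connected_simple_graph_axioms
    by (simp add: bipartite_block_def bipartite_block_axioms_def two_connected_def)
  have sub: "verts B \<subseteq> verts G" "simple_graph B" if "B \<in> \<B>" for B
    using bipartite_block.verts_B[OF bb[OF that]] bipartite_block.simple_B[OF bb[OF that]] .
  have "\<forall>B\<in>\<B>. \<exists>m. (\<forall>v\<in>verts B. m \<le> d x v) \<and>
    (if graph_iso B (cycle_graph 4) then 4 else 8) \<le>
    (\<Sum>y\<in>verts B. int (card (good x y \<inter> edges B)) - (int (d x y) - int m))"
    using bipartite_block.good_sum[OF bb x] by blast
  then obtain m where m: "\<And>B v. B \<in> \<B> \<Longrightarrow> v \<in> verts B \<Longrightarrow> m B \<le> d x v"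
    and sum_m: "\<And>B. B \<in> \<B> \<Longrightarrow> (if graph_iso B (cycle_graph 4) then 4 else 8) \<le>
      (\<Sum>y\<in>verts B. int (card (good x y \<inter> edges B)) - (int (d x y) - int (m B)))"
    unfolding bchoice_iff by blast
  let ?t = "\<lambda>B y. int (card (good x y \<inter> edges B)) - (int (d x y) - int (m B))"
  have "(\<Sum>B\<in>\<B>. if graph_iso B (cycle_graph 4) then 4 else 8) \<le> (\<Sum>B\<in>\<B>. \<Sum>y\<in>verts B. ?t B y)"
    by (intro sum_mono sum_m)
  also have "\<dots> = (\<Sum>B\<in>\<B>. \<Sum>y\<in>{y \<in> verts G. y \<in> verts B}. ?t B y)"
  proof (rule sum.cong[OF refl])
    fix B assume "B \<in> \<B>"
    then have "{y \<in> verts G. y \<in> verts B} = verts B" using sub by blast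
    then show "(\<Sum>y\<in>verts B. ?t B y) = (\<Sum>y\<in>{y \<in> verts G. y \<in> verts B}. ?t B y)" by simp
  qed
  also have "\<dots> = (\<Sum>y\<in>verts G. \<Sum>B\<in>{B \<in> \<B>. y \<in> verts B}. ?t B y)"
    by (rule sum.swap_restrict[OF fin finite_verts])
  also have "\<dots> \<le> (\<Sum>y\<in>verts G. int (card (good x y)) - int (d x y))"
    using blocks_edge_disjoint[OF simple] blocks sub(2) m
    by (intro sum_mono good_excess_ge[OF x _ fin]) auto
  finally show ?thesis .
qed

text \<open>Each of the vertices \<open>x\<close> accounts for at least 8 in the sum for
  \<open>2 * eta G\<close>.\<close>

lemma eta_ge:
  assumes "finite \<B>" and "\<And>B. B \<in> \<B> \<Longrightarrow> block B G \<and> two_connected B \<and> bipartite B"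
    and "8 \<le> (\<Sum>B\<in>\<B>. if graph_iso B (cycle_graph 4) then 4 else 8 :: int)"
  shows "4 * int (card (verts G)) \<le> eta G"
proof -
  have "int (card (verts G)) * 8 \<le> (\<Sum>x\<in>verts G. \<Sum>y\<in>verts G. int (card (good x y)) - int (d x y))"
    using order_trans[OF assms(3) vertex_excess_ge[OF _ assms(1,2)]]
    by (intro sum_bounded_below) blast
  then show ?thesis unfolding eta_eq[symmetric] by simp
qed

end

text \<open>This puts four-cycle blocks, given only up to isomorphism, under the block estimates.
  Being a block excludes cut-vertices, and the parity of the position on the cycle gives the two
  classes.\<close>

lemma C4_block:
  assumes "block B G" "graph_iso B (cycle_graph 4)"
  shows "two_connected B" "bipartite B"
proof -
  obtain f where f: "bij_betw f (verts B) {..<4}"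
    and iso: "\<And>u v. u \<in> verts B \<Longrightarrow> v \<in> verts B \<Longrightarrow>
      {u, v} \<in> edges B \<longleftrightarrow> {f u, f v} \<in> edges (cycle_graph 4)"
    using assms(2) by (auto simp: graph_iso_def cycle_graph_def)
  have "card (verts B) = 4" using bij_betw_same_card[OF f] by simp
  then show "two_connected B"
    using assms(1) by (simp add: two_connected_def block_def)
  have B: "simple_graph B" using assms(1) by (auto simp: block_def subgraph_def)
  have parity: "even (f u) \<noteq> even (f v)" if "u \<in> verts B" "v \<in> verts B" "{u, v} \<in> edges B" for u v
  proof -
    have "{f u, f v} \<in> edges (cycle_graph 4)" using iso that by blast
    then obtain i where i: "i < 4" "{f u, f v} = {i, Suc i mod 4}"
      by (auto simp: cycle_graph_def)
    \<comment> \<open>The wrap-around from 3 to 0 also changes parity, because 4 is even.\<close>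
    have "even i \<noteq> even (Suc i mod 4)" using i(1) by presburger
    then show ?thesis using i(2) by (auto simp: doubleton_eq_iff)
  qed
  show "bipartite B"
    unfolding bipartite_def
  proof (intro exI conjI ballI)
    let ?X = "{v \<in> verts B. even (f v)}" and ?Y = "{v \<in> verts B. odd (f v)}"
    show "?X \<union> ?Y = verts B" "?X \<inter> ?Y = {}" by auto
    fix e assume "e \<in> edges B"
    then obtain u v where uv: "e = {u, v}" "u \<in> verts B" "v \<in> verts B" "{u, v} \<in> edges B"
      using simple_edgeE[OF B] by metis
    then show "\<exists>x\<in>?X. \<exists>y\<in>?Y. e = {x, y}"
      using parity[OF uv(2-4)] insert_commute[of u v "{}"] by (cases "even (f u)") auto
  qed
qed

theorem theorem18:
  fixes G :: "'a ugraph" and n :: nat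
  assumes "simple_graph G"
    and "connected_graph G"
    and "card (verts G) = n"
    and "(\<exists>B. block B G \<and> two_connected B \<and> bipartite B \<and> \<not> graph_iso B (cycle_graph 4)) \<or>
         (\<exists>B1 B2. B1 \<noteq> B2 \<and> block B1 G \<and> graph_iso B1 (cycle_graph 4) \<and>
                  block B2 G \<and> graph_iso B2 (cycle_graph 4))"
  shows "eta G \<ge> 4 * int n"
proof -
  interpret connected_simple_graph G
    using assms(1,2) by unfold_locales
  from assms(4) consider
    B where "block B G" "two_connected B" "bipartite B" "\<not> graph_iso B (cycle_graph 4)"
  | B1 B2 where "B1 \<noteq> B2" "block B1 G" "graph_iso B1 (cycle_graph 4)"
      "block B2 G" "graph_iso B2 (cycle_graph 4)"
    by blast
  then show ?thesis
  proof cases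
    case 1
    then show ?thesis using eta_ge[of "{B}"] assms(3) by simp
  next
    case 2
    then have "block B G \<and> two_connected B \<and> bipartite B" if "B \<in> {B1, B2}" for B
      using C4_block that by blast
    \<comment> \<open>As \<open>B1\<close> and \<open>B2\<close> differ, the sum over the set has
      two terms and equals 4 + 4.\<close>
    then show ?thesis using eta_ge[of "{B1, B2}"] 2 assms(3) by simp
  qed
qed

end
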